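(* Let $d\ge1$, let $\mathbb{F}$ be the flip operator on $\mathbb{C}^d\otimes\mathbb{C}^d$, $\mathbb{F}|k,l\rangle=|l,k\rangle$, let $|\Omega\rangle=d^{-1/2}\sum_{j=1}^d|j,j\rangle$, and let $\mathcal{U}=\mathrm{conv}\{(\mathbb{1}\otimes U)|\Omega\rangle\langle\Omega|(\mathbb{1}\otimes U^\dagger): U\in\mathcal{M}_d\text{ unitary}\}$. Let $B\in\mathcal{M}_d$ have singular values $\sigma_1\ge\dots\ge\sigma_d$, let $w\in\mathbb{R}$ and $W=(\mathbb{1}\otimes B)\mathbb{F}(\mathbb{1}\otimes B^\dagger)+w\,\mathbb{1}$. Then $\operatorname{tr}[W\sigma]\ge0$ for all $\sigma\in\mathcal{U}$ if and only if $$w\ge\frac1d\begin{cases}2\sum_{i=1}^{d/2}\sigma_{2i-1}\sigma_{2i}, & d\text{ even},\\ 2\Big(\sum_{i=1}^{(d-1)/2}\sigma_{2i-1}\sigma_{2i}\Big)-\sigma_d^2, & d\text{ odd}.\end{cases}$$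
   Context: A Hermitian operator $W$ with $\operatorname{tr}[W\sigma]\ge 0$ for all $\sigma\in\mathcal{U}$ is called a separation witness; $\mathcal{U}$ is the set of Jamiolkowski (Choi) states of convex combinations of unitary channels. *)

theory Defs
  imports "Jordan_Normal_Form.Char_Poly"
begin

text \<open>Matrices are Jordan_Normal_Form matrices over complex numbers.
  The tensor space C^d (x) C^d is identified with C^(d*d) via |k,l> = e_(k*d+l)
  (0-based indices k,l < d).\<close>

definition adj :: "complex mat \<Rightarrow> complex mat" where
  "adj A = mat (dim_col A) (dim_row A) (\<lambda>(i,j). cnj (A $$ (j,i)))"

definition mtrace :: "complex mat \<Rightarrow> complex" where
  "mtrace A = (\<Sum>i<dim_row A. A $$ (i,i))"

definition unitary_mat :: "nat \<Rightarrow> complex mat \<Rightarrow> bool" where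
  "unitary_mat d U \<longleftrightarrow> U \<in> carrier_mat d d \<and> adj U * U = 1\<^sub>m d"

definition kron :: "complex mat \<Rightarrow> complex mat \<Rightarrow> complex mat" where
  "kron A B = mat (dim_row A * dim_row B) (dim_col A * dim_col B)
     (\<lambda>(i,j). A $$ (i div dim_row B, j div dim_col B) * B $$ (i mod dim_row B, j mod dim_col B))"

definition flip :: "nat \<Rightarrow> complex mat" where
  "flip d = mat (d*d) (d*d) (\<lambda>(i,j). if i = (j mod d) * d + j div d then 1 else 0)"

definition omega :: "nat \<Rightarrow> complex vec" where
  "omega d = vec (d*d) (\<lambda>i. if i div d = i mod d then complex_of_real (1 / sqrt (real d)) else 0)"

definition ketbra :: "complex vec \<Rightarrow> complex mat" where
  "ketbra v = mat (dim_vec v) (dim_vec v) (\<lambda>(i,j). v $ i * cnj (v $ j))"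

definition choi_unitary :: "nat \<Rightarrow> complex mat \<Rightarrow> complex mat" where
  "choi_unitary d U = kron (1\<^sub>m d) U * ketbra (omega d) * kron (1\<^sub>m d) (adj U)"

definition unitary_choi_hull :: "nat \<Rightarrow> complex mat set" where
  "unitary_choi_hull d = {\<sigma>. \<exists>(n::nat) (p::nat \<Rightarrow> real) (Us::nat \<Rightarrow> complex mat).
       (\<forall>k<n. p k \<ge> 0 \<and> unitary_mat d (Us k)) \<and> (\<Sum>k<n. p k) = 1 \<and>
       \<sigma> = mat (d*d) (d*d) (\<lambda>(i,j). \<Sum>k<n. complex_of_real (p k) * choi_unitary d (Us k) $$ (i,j))}"

definition singular_values :: "nat \<Rightarrow> complex mat \<Rightarrow> (nat \<Rightarrow> real) \<Rightarrow> bool" where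
  "singular_values d B s \<longleftrightarrow>
     (\<forall>i\<in>{1..d}. s i \<ge> 0) \<and> (\<forall>i j. 1 \<le> i \<longrightarrow> i \<le> j \<longrightarrow> j \<le> d \<longrightarrow> s j \<le> s i) \<and>
     char_poly (adj B * B) = (\<Prod>i=1..d. [:- complex_of_real ((s i)\<^sup>2), 1:])"

end

theory Submission
  imports Defs "HOL-Computational_Algebra.Formal_Power_Series"
begin

text \<open>
  For unitary \<open>U\<close> put \<open>A = B\<^sup>\<dagger> U\<close>; then \<open>tr (W \<sigma>\<^sub>U) = w + tr (conj A * A) / d\<close>. A singular value
  decomposition of \<open>B\<close> turns \<open>tr (conj A * A)\<close> into \<open>\<Sum>\<^sub>i\<^sub>j \<sigma>\<^sub>i \<sigma>\<^sub>j cnj (Y\<^sub>i\<^sub>j) Y\<^sub>j\<^sub>i\<close>, where \<open>Y\<close> runs through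
  all unitaries as \<open>U\<close> does, so this real quantity has to be minimised over \<open>Y\<close>.

  Since \<open>\<sigma>\<close> is nonnegative and decreasing, Abel summation in both indices reduces the claim to the
  partial sums \<open>G a b = \<Sum>\<^sub>i\<^sub><\<^sub>a \<Sum>\<^sub>j\<^sub><\<^sub>b Re (cnj (Y\<^sub>i\<^sub>j) Y\<^sub>j\<^sub>i)\<close>: one unitary minimises all of them
  simultaneously. Unit rows and columns give \<open>G a b \<ge> - min a b\<close>. For odd \<open>a = b\<close> the
  antisymmetric part of the leading block is a singular contraction, so its squared Frobenius norm
  is at most \<open>a - 1\<close>; hence \<open>G a a \<ge> - (a - 1)\<close>, and \<open>G d d \<ge> - (d - 2)\<close> if \<open>d\<close> is odd, because
  the full matrix has squared Frobenius norm \<open>d\<close>. The block-diagonal antisymmetric unitary attains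
  all these bounds.
\<close>

subsection \<open>Singular value decomposition\<close>

lemma index_mult_mat_sum:
  assumes "A \<in> carrier_mat n m" "B \<in> carrier_mat m p" "i < n" "j < p"
  shows "(A * B) $$ (i,j) = (\<Sum>k<m. A $$ (i,k) * B $$ (k,j))"
  using assms by (simp add: scalar_prod_def atLeast0LessThan)

lemma adj_carrier [simp]: "A \<in> carrier_mat n m \<Longrightarrow> adj A \<in> carrier_mat m n"
  by (simp add: adj_def)

lemma adj_dim [simp]: "dim_row (adj A) = dim_col A" "dim_col (adj A) = dim_row A"
  by (simp_all add: adj_def)

lemma adj_index [simp]: "A \<in> carrier_mat n m \<Longrightarrow> i < m \<Longrightarrow> j < n \<Longrightarrow> adj A $$ (i,j) = cnj (A $$ (j,i))"
  by (simp add: adj_def)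

lemma adj_adj [simp]: "adj (adj A) = A"
  by (rule eq_matI) (auto simp: adj_def)

lemma adj_one [simp]: "adj (1\<^sub>m n) = 1\<^sub>m n"
  by (rule eq_matI) (auto simp: adj_def)

lemma adj_mult:
  assumes "A \<in> carrier_mat n m" "B \<in> carrier_mat m p"
  shows "adj (A * B) = adj B * adj A"
proof (rule eq_matI)
  note AB = mult_carrier_mat[OF assms]
  have dims: "dim_row A = n" "dim_col A = m" "dim_row B = m" "dim_col B = p"
    using assms by auto
  fix i j assume "i < dim_row (adj B * adj A)" "j < dim_col (adj B * adj A)"
  then have ij: "i < p" "j < n" by (simp_all add: adj_def dims)
  show "adj (A * B) $$ (i,j) = (adj B * adj A) $$ (i,j)"
    using ij assms adj_index[OF AB ij]
    by (simp add: index_mult_mat_sum[of _ n m _ p] index_mult_mat_sum[of _ p m _ n] mult.commute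
        del: index_mult_mat)
qed (auto simp: adj_def)

lemma unitary_matD:
  assumes "unitary_mat d U"
  shows "U \<in> carrier_mat d d" "adj U * U = 1\<^sub>m d" "U * adj U = 1\<^sub>m d"
proof -
  show U: "U \<in> carrier_mat d d" and inv: "adj U * U = 1\<^sub>m d"
    using assms by (simp_all add: unitary_mat_def)
  show "U * adj U = 1\<^sub>m d"
    by (rule mat_mult_left_right_inverse[OF adj_carrier[OF U] U inv])
qed

lemma unitary_mat_adj: "unitary_mat d U \<Longrightarrow> unitary_mat d (adj U)"
  using unitary_matD[of d U] unfolding unitary_mat_def by simp

lemma unitary_mat_mult:
  assumes "unitary_mat d U" "unitary_mat d V"
  shows "unitary_mat d (U * V)"
proof -
  note U = unitary_matD[OF assms(1)] and V = unitary_matD[OF assms(2)]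
  have "adj (U * V) * (U * V) = adj V * (adj U * (U * V))"
    using U V by (simp add: adj_mult[of _ d d _ d] assoc_mult_mat[of _ d d _ d _ d] mult_carrier_mat[of _ d d _ d])
  also have "adj U * (U * V) = (adj U * U) * V"
    using U V by (subst assoc_mult_mat[of _ d d _ d _ d]) auto
  finally show ?thesis using U V by (simp add: unitary_mat_def)
qed

lemma unitary_mat_iff:
  assumes "U \<in> carrier_mat d d"
  shows "unitary_mat d U \<longleftrightarrow>
    (\<forall>i<d. \<forall>j<d. (\<Sum>k<d. cnj (U $$ (k,i)) * U $$ (k,j)) = (if i = j then 1 else 0))"
proof -
  have idx: "(adj U * U) $$ (i,j) = (\<Sum>k<d. cnj (U $$ (k,i)) * U $$ (k,j))" if "i < d" "j < d" for i j
    using that assms by (simp add: index_mult_mat_sum[of _ d d _ d] del: index_mult_mat)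
  have "adj U * U = 1\<^sub>m d \<longleftrightarrow> (\<forall>i<d. \<forall>j<d. (adj U * U) $$ (i,j) = (if i = j then 1 else 0))"
  proof
    assume R: "\<forall>i<d. \<forall>j<d. (adj U * U) $$ (i,j) = (if i = j then 1 else 0)"
    show "adj U * U = 1\<^sub>m d"
      by (rule eq_matI) (use R assms in \<open>auto simp del: index_mult_mat(1)\<close>)
  qed simp
  then show ?thesis using assms idx by (simp add: unitary_mat_def)
qed

section \<open>Completing orthonormal families to unitary matrices\<close>

lemma exists_normalization:
  fixes v :: "complex vec"
  assumes "v \<in> carrier_vec n" "v \<noteq> 0\<^sub>v n"
  obtains c where "(\<Sum>k<n. cnj (c * v $ k) * (c * v $ k)) = 1"
proof -
  define N where "N = (\<Sum>k<n. (cmod (v $ k))\<^sup>2)"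
  have "N > 0"
  proof -
    obtain k where "k < n" "v $ k \<noteq> 0"
      using assms by (metis carrier_vecD eq_vecI index_zero_vec)
    then show ?thesis unfolding N_def by (intro sum_pos2[of _ k]) auto
  qed
  define c where "c = complex_of_real (1 / sqrt N)"
  have c: "cnj c * c = 1 / of_real N"
    using \<open>N > 0\<close> by (simp add: c_def flip: of_real_mult)
  have "(\<Sum>k<n. cnj (c * v $ k) * (c * v $ k)) = (\<Sum>k<n. cnj c * c * of_real ((cmod (v $ k))\<^sup>2))"
    by (intro sum.cong refl) (simp only: complex_norm_square complex_cnj_mult mult_ac)
  also have "\<dots> = cnj c * c * of_real N"
    by (simp only: N_def of_real_sum sum_distrib_left)
  finally show thesis using that[of c] c \<open>N > 0\<close> by simp
qed

text \<open>Put the conjugated vectors with index in \<open>R\<close> into the rows of a square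
  matrix and zeros into the other rows. Row \<open>j\<close> is zero, so the determinant vanishes
  and a kernel vector can be normalised.\<close>

lemma exists_unit_vec_orthogonal:
  fixes u :: "nat \<Rightarrow> nat \<Rightarrow> complex"
  assumes "j < n" "j \<notin> R"
  obtains x where "\<And>i. i \<in> R \<Longrightarrow> i < n \<Longrightarrow> (\<Sum>k<n. cnj (u i k) * x k) = 0"
    and "(\<Sum>k<n. cnj (x k) * x k) = 1"
proof -
  define M where "M = mat n n (\<lambda>(i,k). if i \<in> R then cnj (u i k) else 0)"
  have M: "M \<in> carrier_mat n n" by (simp add: M_def)
  have "M = mat\<^sub>r n n (\<lambda>i. if i = j then 0\<^sub>v n else row M i)"
    by (rule eq_matI) (use assms in \<open>auto simp: M_def\<close>)
  moreover have "det (mat\<^sub>r n n (\<lambda>i. if i = j then 0\<^sub>v n else row M i)) = 0"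
    by (rule det_row_0) (use assms M in auto)
  ultimately have "det M = 0" by simp
  then obtain v where v: "v \<in> carrier_vec n" "v \<noteq> 0\<^sub>v n" "M *\<^sub>v v = 0\<^sub>v n"
    using det_0_iff_vec_prod_zero[OF M] by blast
  obtain c where c: "(\<Sum>k<n. cnj (c * v $ k) * (c * v $ k)) = 1"
    using exists_normalization[OF v(1,2)] .
  show thesis
  proof
    show "(\<Sum>k<n. cnj (c * v $ k) * (c * v $ k)) = 1" by (fact c)
    fix i assume i: "i \<in> R" "i < n"
    have "(M *\<^sub>v v) $ i = (\<Sum>k<n. cnj (u i k) * v $ k)"
      using i M v(1) by (simp add: scalar_prod_def M_def atLeast0LessThan)
    then have "c * (\<Sum>k<n. cnj (u i k) * v $ k) = 0" using v i by simp
    then show "(\<Sum>k<n. cnj (u i k) * (c * v $ k)) = 0"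
      by (simp only: sum_distrib_left mult_ac)
  qed
qed

text \<open>Induction on the number of columns still free. The given vectors keep their column
  positions, so \<open>R\<close> may be any set of indices; the decomposition below needs this for
  the positions of nonzero singular values.\<close>

lemma orthonormal_extension:
  fixes u :: "nat \<Rightarrow> nat \<Rightarrow> complex"
  assumes "R \<subseteq> {..<n}"
    and "\<And>i j. i \<in> R \<Longrightarrow> j \<in> R \<Longrightarrow> (\<Sum>k<n. cnj (u i k) * u j k) = (if i = j then 1 else 0)"
  shows "\<exists>U. unitary_mat n U \<and> (\<forall>i\<in>R. \<forall>k<n. U $$ (k,i) = u i k)"
  using assms
proof (induction "card ({..<n} - R)" arbitrary: R u)
  case 0
  then have "R = {..<n}" by auto
  with 0 have "unitary_mat n (mat n n (\<lambda>(k,i). u i k))"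
    by (subst unitary_mat_iff) auto
  then show ?case using \<open>R = {..<n}\<close> by (intro exI[of _ "mat n n (\<lambda>(k,i). u i k)"]) auto
next
  case (Suc m)
  then obtain j where j: "j < n" "j \<notin> R"
    by (metis Diff_eq_empty_iff card.empty lessThan_iff nat.distinct(1) subsetI)
  obtain x where x: "\<And>i. i \<in> R \<Longrightarrow> i < n \<Longrightarrow> (\<Sum>k<n. cnj (u i k) * x k) = 0"
    and x1: "(\<Sum>k<n. cnj (x k) * x k) = 1"
    using exists_unit_vec_orthogonal[OF j] by blast
  have x': "(\<Sum>k<n. cnj (x k) * u i k) = 0" if "i \<in> R" for i
  proof -
    have "(\<Sum>k<n. cnj (x k) * u i k) = cnj (\<Sum>k<n. cnj (u i k) * x k)"
      by (simp add: mult.commute)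
    also have "(\<Sum>k<n. cnj (u i k) * x k) = 0" using x[of i] that Suc.prems(1) by blast
    finally show ?thesis by simp
  qed
  have "{..<n} - R = insert j ({..<n} - insert j R)" using j by auto
  then have "m = card ({..<n} - insert j R)" using Suc.hyps(2)
    by (metis Diff_iff card_insert_disjoint finite_Diff finite_lessThan insertI1 nat.inject)
  moreover have "insert j R \<subseteq> {..<n}" using j Suc.prems by auto
  moreover have "(\<Sum>k<n. cnj ((u(j := x)) i k) * (u(j := x)) l k) = (if i = l then 1 else 0)"
    if "i \<in> insert j R" "l \<in> insert j R" for i l
    using that j x x' x1 Suc.prems by auto
  ultimately obtain U where U: "unitary_mat n U" "\<forall>i\<in>insert j R. \<forall>k<n. U $$ (k,i) = (u(j := x)) i k"
    using Suc.hyps(1)[of "insert j R" "u(j := x)"] by blast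
  then show ?case using j by (intro exI[of _ U]) auto
qed

section \<open>Unitary diagonalisation and the decomposition of \<open>B\<close>\<close>

definition diagm :: "nat \<Rightarrow> (nat \<Rightarrow> complex) \<Rightarrow> complex mat" where
  "diagm n e = mat n n (\<lambda>(i,j). if i = j then e i else 0)"

lemma diagm_carrier [simp]: "diagm n e \<in> carrier_mat n n"
  by (simp add: diagm_def)

lemma diagm_index [simp]: "i < n \<Longrightarrow> j < n \<Longrightarrow> diagm n e $$ (i,j) = (if i = j then e i else 0)"
  by (simp add: diagm_def)

text \<open>Deflation: a unit eigenvector for \<open>e 0\<close> becomes the first column of a
  unitary, and hermiticity clears the first row along with the first column. The remaining block is
  again Hermitian with the other linear factors, so the eigenvalues come out in the prescribed
  order.\<close>

lemma hermitian_unitarily_diagonalizable: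
  assumes "H \<in> carrier_mat n n" "adj H = H" "char_poly H = (\<Prod>i<n. [:- e i, 1:])"
  shows "\<exists>P. unitary_mat n P \<and> adj P * H * P = diagm n e"
  using assms
proof (induction n arbitrary: H e)
  case 0
  have "unitary_mat 0 (1\<^sub>m 0)" "adj (1\<^sub>m 0) * H * 1\<^sub>m 0 = diagm 0 e"
    using 0 by (auto simp: unitary_mat_def diagm_def)
  then show ?case by blast
next
  case (Suc n)
  note H = Suc.prems(1)
  have "poly (char_poly H) (e 0) = 0"
    unfolding Suc.prems(3) poly_prod by (rule prod_zero) auto
  then obtain v where v: "v \<in> carrier_vec (Suc n)" "v \<noteq> 0\<^sub>v (Suc n)" "H *\<^sub>v v = e 0 \<cdot>\<^sub>v v"
    using eigenvalue_root_char_poly[OF H] H unfolding eigenvalue_def eigenvector_def by auto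
  obtain c where c: "(\<Sum>k<Suc n. cnj (c * v $ k) * (c * v $ k)) = 1"
    using exists_normalization[OF v(1,2)] .
  define x where "x k = c * v $ k" for k
  have "(\<Sum>k<Suc n. cnj (x k) * x k) = 1" using c unfolding x_def .
  then obtain W where W: "unitary_mat (Suc n) W" and Wx: "\<forall>k<Suc n. W $$ (k,0) = x k"
    using orthonormal_extension[of "{0}" "Suc n" "\<lambda>_. x"] by auto
  note WD = unitary_matD[OF W]
  define M where "M = adj W * H * W"
  have M: "M \<in> carrier_mat (Suc n) (Suc n)" using WD H by (simp add: M_def mult_carrier_mat[of _ "Suc n" "Suc n" _ "Suc n"])
  have HW: "H * W \<in> carrier_mat (Suc n) (Suc n)" using WD H by simp
  have HW0: "(H * W) $$ (i,0) = e 0 * W $$ (i,0)" if i: "i < Suc n" for i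
  proof -
    have "(H * W) $$ (i,0) = (\<Sum>k<Suc n. H $$ (i,k) * x k)"
      using i Wx WD H by (subst index_mult_mat_sum[of _ "Suc n" "Suc n" _ "Suc n"]) (auto simp del: sum.lessThan_Suc)
    also have "\<dots> = c * (\<Sum>k<Suc n. H $$ (i,k) * v $ k)"
      by (simp only: x_def sum_distrib_left mult_ac)
    also have "(\<Sum>k<Suc n. H $$ (i,k) * v $ k) = (H *\<^sub>v v) $ i"
      using i H v(1) by (simp add: scalar_prod_def atLeast0LessThan del: sum.lessThan_Suc)
    also have "\<dots> = e 0 * v $ i" using v i by simp
    finally show ?thesis using Wx i by (simp add: x_def)
  qed
  have M0: "M $$ (i,0) = (if i = 0 then e 0 else 0)" if i: "i < Suc n" for i
  proof -
    have "M $$ (i,0) = (adj W * (H * W)) $$ (i,0)"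
      using WD H unfolding M_def by (subst assoc_mult_mat[of _ "Suc n" "Suc n" _ "Suc n" _ "Suc n"]) auto
    also have "\<dots> = (\<Sum>k<Suc n. adj W $$ (i,k) * (H * W) $$ (k,0))"
      using i WD HW by (intro index_mult_mat_sum[of _ "Suc n" "Suc n" _ "Suc n"]) auto
    also have "\<dots> = e 0 * (\<Sum>k<Suc n. adj W $$ (i,k) * W $$ (k,0))"
      using HW0 by (simp add: sum_distrib_left mult_ac del: sum.lessThan_Suc)
    also have "(\<Sum>k<Suc n. adj W $$ (i,k) * W $$ (k,0)) = (adj W * W) $$ (i,0)"
      using i WD by (intro index_mult_mat_sum[of _ "Suc n" "Suc n" _ "Suc n", symmetric]) auto
    finally show ?thesis using WD i by simp
  qed
  have Mh: "adj M = M"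
    using WD H Suc.prems(2) by (simp add: M_def adj_mult[of _ "Suc n" "Suc n" _ "Suc n"]
        assoc_mult_mat[of _ "Suc n" "Suc n" _ "Suc n" _ "Suc n"]
        mult_carrier_mat[of _ "Suc n" "Suc n" _ "Suc n"])
  define M' where "M' = mat n n (\<lambda>(i,j). M $$ (Suc i, Suc j))"
  define E where "E = mat 1 1 (\<lambda>_. e 0)"
  have M': "M' \<in> carrier_mat n n" and E: "E \<in> carrier_mat 1 1" by (simp_all add: M'_def E_def)
  have M0': "M $$ (0,i) = (if i = 0 then e 0 else 0)" if i: "i < Suc n" for i
  proof -
    have h: "M $$ (0,i) = cnj (M $$ (i,0))"
      using adj_index[OF M, of 0 i] i Mh by simp
    show ?thesis
    proof (cases "i = 0")
      case True
      then show ?thesis using M0[OF i] by simp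
    next
      case False
      then show ?thesis using M0[OF i] h by simp
    qed
  qed
  have Mb: "M = four_block_mat E (0\<^sub>m 1 n) (0\<^sub>m n 1) M'"
    by (rule eq_matI) (use M M0 M0' in \<open>auto simp: M'_def E_def four_block_mat_def Let_def\<close>)
  \<comment> \<open>Similarity transports the given factorisation of the characteristic polynomial
    to the block form.\<close>
  have "similar_mat H M"
  proof (rule similar_matI[of _ _ W "adj W" "Suc n"])
    have "W * M * adj W = (W * adj W) * H * (W * adj W)"
      using WD(1) H by (simp add: M_def assoc_mult_mat[of _ "Suc n" "Suc n" _ "Suc n" _ "Suc n"]
        mult_carrier_mat[of _ "Suc n" "Suc n" _ "Suc n"])
    then show "H = W * M * adj W" using WD H by simp
  qed (use WD H M in auto)
  then have "char_poly H = char_poly M" by (rule char_poly_similar)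
  also have "\<dots> = char_poly E * char_poly M'"
    unfolding Mb by (rule char_poly_four_block_zeros_col) (use E M' in auto)
  also have "char_poly E = [:- e 0, 1:]"
    by (simp add: char_poly_def char_poly_matrix_def E_def det_single)
  \<comment> \<open>The left side of the chain is now replaced by the given product, so that the
    factor of \<open>e 0\<close> can be cancelled.\<close>
  also have "char_poly H = [:- e 0, 1:] * (\<Prod>i<n. [:- e (Suc i), 1:])"
    unfolding Suc.prems(3) by (rule prod.lessThan_Suc_shift)
  finally have cp: "char_poly M' = (\<Prod>i<n. [:- e (Suc i), 1:])" 
    by (metis mult_left_cancel one_neq_zero pCons_eq_0_iff)
  have "adj M' = M'"
  proof (rule eq_matI)
    fix i j assume "i < dim_row M'" "j < dim_col M'"
    then have ij: "i < n" "j < n" using M' by auto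
    have "adj M $$ (Suc i, Suc j) = cnj (M $$ (Suc j, Suc i))" using M ij by simp
    then show "adj M' $$ (i,j) = M' $$ (i,j)" using Mh ij unfolding adj_index[OF M' ij(1,2)] by (simp add: M'_def)
  qed (use M' in \<open>auto simp: adj_def\<close>)
  from Suc.IH[OF M' this cp] obtain P' where P': "unitary_mat n P'"
    and D': "adj P' * M' * P' = diagm n (\<lambda>i. e (Suc i))" by blast
  note P'D = unitary_matD[OF P']
  \<comment> \<open>The diagonalising unitary of the small block is bordered by 1, which leaves the
    first basis vector fixed.\<close>
  define Q where "Q = four_block_mat (1\<^sub>m 1) (0\<^sub>m 1 n) (0\<^sub>m n 1) P'"
  have Q: "Q \<in> carrier_mat (Suc n) (Suc n)"
    using P'D four_block_carrier_mat[of "1\<^sub>m 1" 1 1 P' n n] by (simp add: Q_def)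
  have aQ: "adj Q = four_block_mat (1\<^sub>m 1) (0\<^sub>m 1 n) (0\<^sub>m n 1) (adj P')"
    by (rule eq_matI) (use P'D in \<open>auto simp: Q_def four_block_mat_def Let_def adj_def\<close>)
  have "adj Q * Q = four_block_mat (1\<^sub>m 1) (0\<^sub>m 1 n) (0\<^sub>m n 1) (1\<^sub>m n)"
    unfolding aQ unfolding Q_def
    by (subst mult_four_block_mat[of _ 1 1 _ n _ n _ _ 1 _ n]) (use P'D in auto)
  also have "\<dots> = 1\<^sub>m (Suc n)" by (rule eq_matI) (auto simp: four_block_mat_def Let_def)
  finally have uQ: "unitary_mat (Suc n) Q" using Q by (simp add: unitary_mat_def)
  have "adj Q * M = four_block_mat E (0\<^sub>m 1 n) (0\<^sub>m n 1) (adj P' * M')"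
    unfolding aQ Mb
    by (subst mult_four_block_mat[of _ 1 1 _ n _ n _ _ 1 _ n]) (use P'D M' E in auto)
  then have "adj Q * M * Q = four_block_mat E (0\<^sub>m 1 n) (0\<^sub>m n 1) (diagm n (\<lambda>i. e (Suc i)))"
    unfolding Q_def D'[symmetric]
    by (simp, subst mult_four_block_mat[of _ 1 1 _ n _ n _ _ 1 _ n]) (use P'D M' E in auto)
  also have "\<dots> = diagm (Suc n) e"
    by (rule eq_matI) (auto simp: four_block_mat_def Let_def diagm_def E_def)
  finally have "adj Q * M * Q = diagm (Suc n) e" .
  moreover have "adj (W * Q) * H * (W * Q) = adj Q * M * Q"
    using WD(1) H Q by (simp add: M_def adj_mult[of _ "Suc n" "Suc n" _ "Suc n"]
        assoc_mult_mat[of _ "Suc n" "Suc n" _ "Suc n" _ "Suc n"]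
        mult_carrier_mat[of _ "Suc n" "Suc n" _ "Suc n"])
  ultimately show ?case using unitary_mat_mult[OF W uQ] by (intro exI[of _ "W * Q"]) auto
qed

text \<open>If \<open>P\<close> diagonalises \<open>adj B * B\<close>, the columns of
  \<open>B * P\<close> are orthogonal with squared norms \<open>(\<sigma> i)\<^sup>2\<close>. The
  nonzero ones, divided by \<open>\<sigma> i\<close>, are columns of the left unitary.\<close>

lemma singular_value_decomposition:
  assumes B: "B \<in> carrier_mat d d"
    and cp: "char_poly (adj B * B) = (\<Prod>i<d. [:- complex_of_real ((\<sigma> i)\<^sup>2), 1:])"
  shows "\<exists>U P. unitary_mat d U \<and> unitary_mat d P \<and> B = U * diagm d (\<lambda>i. complex_of_real (\<sigma> i)) * adj P"
proof -
  have "adj (adj B * B) = adj B * B" using B by (simp add: adj_mult[of _ d d _ d])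
  then obtain P where P: "unitary_mat d P"
    and D: "adj P * (adj B * B) * P = diagm d (\<lambda>i. complex_of_real ((\<sigma> i)\<^sup>2))"
    using hermitian_unitarily_diagonalizable[OF _ _ cp] B by (metis adj_carrier mult_carrier_mat)
  note PD = unitary_matD[OF P]
  define C where "C = B * P"
  have C: "C \<in> carrier_mat d d" using B PD by (simp add: C_def)
  have "adj C * C = diagm d (\<lambda>i. complex_of_real ((\<sigma> i)\<^sup>2))"
    unfolding D[symmetric] using B PD(1) by (simp add: C_def adj_mult[of _ d d _ d] assoc_mult_mat[of _ d d _ d _ d] mult_carrier_mat[of _ d d _ d])
  then have CC: "(\<Sum>k<d. cnj (C $$ (k,i)) * C $$ (k,j)) = (if i = j then complex_of_real ((\<sigma> i)\<^sup>2) else 0)"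
    if "i < d" "j < d" for i j
    using that C index_mult_mat_sum[of "adj C" d d C d i j, symmetric] by (simp del: index_mult_mat)
  define R where "R = {i. i < d \<and> \<sigma> i \<noteq> 0}"
  define u where "u i k = C $$ (k,i) / of_real (\<sigma> i)" for i k
  have "(\<Sum>k<d. cnj (u i k) * u j k) = (if i = j then 1 else 0)" if "i \<in> R" "j \<in> R" for i j
  proof -
    have "(\<Sum>k<d. cnj (u i k) * u j k) = (\<Sum>k<d. cnj (C $$ (k,i)) * C $$ (k,j)) / of_real (\<sigma> i * \<sigma> j)"
      unfolding sum_divide_distrib by (simp add: u_def)
    then show ?thesis using that CC[of i j] by (auto simp: R_def power2_eq_square)
  qed
  moreover have "R \<subseteq> {..<d}" by (auto simp: R_def)
  ultimately obtain U where U: "unitary_mat d U" and Uu: "\<forall>i\<in>R. \<forall>k<d. U $$ (k,i) = u i k"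
    using orthonormal_extension[of R d u] by blast
  note UD = unitary_matD[OF U]
  let ?S = "diagm d (\<lambda>i. complex_of_real (\<sigma> i))"
  have "C = U * ?S"
  proof (rule eq_matI)
    fix k i assume "k < dim_row (U * ?S)" "i < dim_col (U * ?S)"
    then have ki: "k < d" "i < d" using UD by (auto simp: diagm_def)
    have eq: "(U * ?S) $$ (k,i) = U $$ (k,i) * of_real (\<sigma> i)"
      using ki UD by (subst index_mult_mat_sum[of _ d d _ d]) (auto simp: if_distrib cong: if_cong)
    show "C $$ (k,i) = (U * ?S) $$ (k,i)"
    proof (cases "\<sigma> i = 0")
      case True
      \<comment> \<open>Column \<open>i\<close> of \<open>U\<close> is arbitrary here; a vanishing
        squared norm forces the column of \<open>C\<close> to be zero, so the product still
        agrees.\<close>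
      have "complex_of_real (\<Sum>k<d. (cmod (C $$ (k,i)))\<^sup>2) = (\<Sum>k<d. cnj (C $$ (k,i)) * C $$ (k,i))"
        unfolding of_real_sum complex_norm_square by (simp add: mult.commute)
      also have "\<dots> = 0" using CC[of i i] ki True by simp
      finally have "(\<Sum>k<d. (cmod (C $$ (k,i)))\<^sup>2) = 0" by (simp only: of_real_eq_0_iff)
      then have "C $$ (k,i) = 0" using ki by (subst (asm) sum_nonneg_eq_0_iff) auto
      then show ?thesis using eq True by simp
    next
      case False
      then show ?thesis using Uu ki eq by (auto simp: R_def u_def)
    qed
  qed (use C UD in \<open>auto simp: diagm_def\<close>)
  then have "C * adj P = U * ?S * adj P" by simp
  moreover have "C * adj P = B"
    unfolding C_def using PD B by (simp add: assoc_mult_mat[of _ d d _ d _ d] mult_carrier_mat[of _ d d _ d])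
  ultimately show ?thesis using U P by auto
qed

subsection \<open>Minimisation over unitary matrices\<close>

lemma abel_summation_nonneg:
  fixes \<sigma> f :: "nat \<Rightarrow> real"
  assumes dec: "\<And>i. Suc i < d \<Longrightarrow> \<sigma> (Suc i) \<le> \<sigma> i"
    and nonneg: "\<And>i. i < d \<Longrightarrow> 0 \<le> \<sigma> i"
    and partial: "\<And>a. a \<le> d \<Longrightarrow> 0 \<le> (\<Sum>i<a. f i)"
  shows "0 \<le> (\<Sum>i<d. \<sigma> i * f i)"
proof -
  \<comment> \<open>Nonnegativity alone would not carry the induction. Keeping the last weight times
    the partial sum as lower bound does: passing to the smaller weight
    \<open>\<sigma> (Suc n)\<close> can only decrease that product.\<close>
  have *: "n < d \<Longrightarrow> \<sigma> n * (\<Sum>i<Suc n. f i) \<le> (\<Sum>i<Suc n. \<sigma> i * f i)" for n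
  proof (induction n)
    case (Suc n)
    have "\<sigma> (Suc n) * (\<Sum>i<Suc n. f i) \<le> \<sigma> n * (\<Sum>i<Suc n. f i)"
      using dec[of n] partial[of "Suc n"] Suc.prems by (intro mult_right_mono) auto
    also have "\<dots> \<le> (\<Sum>i<Suc n. \<sigma> i * f i)" using Suc by simp
    finally show ?case
      by (simp add: sum.lessThan_Suc[of _ "Suc n"] distrib_left del: sum.lessThan_Suc)
  qed simp
  show ?thesis
  proof (cases d)
    case (Suc n)
    have "0 \<le> \<sigma> n * (\<Sum>i<Suc n. f i)"
      using Suc nonneg[of n] partial[of "Suc n"] by (intro mult_nonneg_nonneg) auto
    also have "\<dots> \<le> (\<Sum>i<d. \<sigma> i * f i)" using *[of n] Suc by simp
    finally show ?thesis .
  qed simp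
qed

text \<open>Summation by parts is applied to \<open>h - g\<close> twice, with the column index
  outside and the row index inside; only rectangular partial sums from the corner remain.\<close>

lemma decreasing_weights_sum_mono:
  fixes \<sigma> :: "nat \<Rightarrow> real" and g h :: "nat \<Rightarrow> nat \<Rightarrow> real"
  assumes dec: "\<And>i. Suc i < d \<Longrightarrow> \<sigma> (Suc i) \<le> \<sigma> i"
    and nonneg: "\<And>i. i < d \<Longrightarrow> 0 \<le> \<sigma> i"
    and partial: "\<And>a b. a \<le> d \<Longrightarrow> b \<le> d \<Longrightarrow> (\<Sum>i<a. \<Sum>j<b. g i j) \<le> (\<Sum>i<a. \<Sum>j<b. h i j)"
  shows "(\<Sum>i<d. \<Sum>j<d. \<sigma> i * \<sigma> j * g i j) \<le> (\<Sum>i<d. \<Sum>j<d. \<sigma> i * \<sigma> j * h i j)"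
proof -
  define k where "k i j = h i j - g i j" for i j
  have "0 \<le> (\<Sum>j<d. \<sigma> j * (\<Sum>i<d. \<sigma> i * k i j))"
  proof (rule abel_summation_nonneg[where d = d and \<sigma> = \<sigma>, OF dec nonneg])
    fix b assume b: "b \<le> d"
    have "0 \<le> (\<Sum>i<d. \<sigma> i * (\<Sum>j<b. k i j))"
    proof (rule abel_summation_nonneg[where d = d and \<sigma> = \<sigma>, OF dec nonneg])
      fix a assume "a \<le> d"
      then show "0 \<le> (\<Sum>i<a. \<Sum>j<b. k i j)"
        using partial[of a b] b by (simp add: k_def sum_subtractf)
    qed
    also have "\<dots> = (\<Sum>j<b. \<Sum>i<d. \<sigma> i * k i j)"
      unfolding sum_distrib_left by (rule sum.swap)
    finally show "0 \<le> (\<Sum>j<b. \<Sum>i<d. \<sigma> i * k i j)" .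
  qed
  also have "\<dots> = (\<Sum>i<d. \<Sum>j<d. \<sigma> i * \<sigma> j * k i j)"
    unfolding sum_distrib_left by (subst sum.swap) (simp add: mult_ac)
  also have "\<dots> = (\<Sum>i<d. \<Sum>j<d. \<sigma> i * \<sigma> j * h i j) - (\<Sum>i<d. \<Sum>j<d. \<sigma> i * \<sigma> j * g i j)"
    by (simp add: k_def right_diff_distrib sum_subtractf)
  finally show ?thesis by simp
qed

section \<open>Norm estimates for unitary matrices and their leading blocks\<close>

lemma unitary_mat_transpose:
  assumes "unitary_mat d U"
  shows "unitary_mat d (transpose_mat U)"
proof -
  note U = unitary_matD[OF assms]
  have "(\<Sum>k<d. cnj (U $$ (i,k)) * U $$ (j,k)) = (if i = j then 1 else 0)" if ij: "i < d" "j < d" for i j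
  proof -
    have "(\<Sum>k<d. cnj (U $$ (i,k)) * U $$ (j,k)) = (U * adj U) $$ (j,i)"
      using ij U(1) by (subst index_mult_mat_sum[of _ d d _ d]) (auto simp: mult.commute)
    then show ?thesis using U ij by auto
  qed
  then show ?thesis using U(1) by (subst unitary_mat_iff) auto
qed

lemma unitary_mat_isometry:
  assumes "unitary_mat d U"
  shows "(\<Sum>i<d. (cmod (\<Sum>j<d. U $$ (i,j) * x j))\<^sup>2) = (\<Sum>j<d. (cmod (x j))\<^sup>2)"
proof -
  have orth: "(\<Sum>k<d. cnj (U $$ (k,i)) * U $$ (k,j)) = (if i = j then 1 else 0)" if "i < d" "j < d" for i j
    using assms that unitary_mat_iff[OF unitary_matD(1)[OF assms]] by blast
  have "complex_of_real (\<Sum>i<d. (cmod (\<Sum>j<d. U $$ (i,j) * x j))\<^sup>2)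
     = (\<Sum>i<d. \<Sum>j<d. \<Sum>l<d. x j * cnj (x l) * (cnj (U $$ (i,l)) * U $$ (i,j)))"
    unfolding of_real_sum complex_norm_square cnj_sum sum_product complex_cnj_mult
    by (simp only: mult_ac)
  also have "\<dots> = (\<Sum>j<d. \<Sum>l<d. \<Sum>i<d. x j * cnj (x l) * (cnj (U $$ (i,l)) * U $$ (i,j)))"
    by (subst sum.swap, rule sum.cong[OF refl], rule sum.swap)
  also have "\<dots> = (\<Sum>j<d. \<Sum>l<d. if l = j then x j * cnj (x l) else 0)"
    unfolding sum_distrib_left[symmetric] by (intro sum.cong refl) (simp add: orth)
  also have "\<dots> = complex_of_real (\<Sum>j<d. (cmod (x j))\<^sup>2)"
    unfolding of_real_sum complex_norm_square by simp
  finally show ?thesis by (simp only: of_real_eq_iff)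
qed

text \<open>Padding \<open>x\<close> with zeros turns the block action into that of the whole
  isometry, with some output coordinates dropped.\<close>

lemma unitary_mat_block_contraction:
  assumes "unitary_mat d U" "a \<le> d"
  shows "(\<Sum>i<a. (cmod (\<Sum>j<a. U $$ (i,j) * x j))\<^sup>2) \<le> (\<Sum>j<a. (cmod (x j))\<^sup>2)"
proof -
  define y where "y j = (if j < a then x j else 0)" for j
  have sub: "{..<a} \<subseteq> {..<d}" using assms by auto
  have eq: "(\<Sum>j<a. U $$ (i,j) * x j) = (\<Sum>j<d. U $$ (i,j) * y j)" for i
    by (rule sum.mono_neutral_cong_left) (use sub in \<open>auto simp: y_def\<close>)
  have "(\<Sum>i<a. (cmod (\<Sum>j<a. U $$ (i,j) * x j))\<^sup>2) \<le> (\<Sum>i<d. (cmod (\<Sum>j<d. U $$ (i,j) * y j))\<^sup>2)"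
    unfolding eq by (rule sum_mono2) (use sub in auto)
  also have "\<dots> = (\<Sum>j<d. (cmod (y j))\<^sup>2)" by (rule unitary_mat_isometry[OF assms(1)])
  also have "\<dots> = (\<Sum>j<a. (cmod (x j))\<^sup>2)"
    by (rule sum.mono_neutral_cong_right) (use sub in \<open>auto simp: y_def\<close>)
  finally show ?thesis .
qed

lemma unitary_mat_col_norm:
  assumes "unitary_mat d U" "j < d"
  shows "(\<Sum>i<d. (cmod (U $$ (i,j)))\<^sup>2) = 1"
proof -
  have "complex_of_real (\<Sum>i<d. (cmod (U $$ (i,j)))\<^sup>2) = (\<Sum>i<d. cnj (U $$ (i,j)) * U $$ (i,j))"
    unfolding of_real_sum complex_norm_square by (simp only: mult.commute)
  also have "\<dots> = 1" using assms unitary_mat_iff[OF unitary_matD(1)[OF assms(1)]] by simp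
  finally show ?thesis by (simp only: of_real_eq_1_iff)
qed

lemma unitary_mat_row_norm:
  assumes "unitary_mat d U" "i < d"
  shows "(\<Sum>j<d. (cmod (U $$ (i,j)))\<^sup>2) = 1"
  using unitary_mat_col_norm[OF unitary_mat_transpose[OF assms(1)] assms(2)]
    unitary_matD(1)[OF assms(1)] assms(2) by simp

lemma norm_diff_square_le: "(cmod (p - q))\<^sup>2 \<le> 2 * ((cmod p)\<^sup>2 + (cmod q)\<^sup>2)"
proof -
  have "(cmod (p - q))\<^sup>2 \<le> (cmod p + cmod q)\<^sup>2"
    by (intro power_mono norm_triangle_ineq4) auto
  also have "\<dots> \<le> 2 * ((cmod p)\<^sup>2 + (cmod q)\<^sup>2)"
    using zero_le_power2[of "cmod p - cmod q"] by (simp add: power2_sum power2_diff)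
  finally show ?thesis .
qed

text \<open>An antisymmetric matrix of odd size has a unit kernel vector \<open>x\<close>, so its \<open>l\<close>-th column is the
  image of \<open>e\<^sub>l - cnj (x\<^sub>l) x\<close>, which has squared norm \<open>1 - \<bar>x\<^sub>l\<bar>\<^sup>2\<close>.\<close>

lemma antisymmetric_part_odd_block:
  assumes Y: "unitary_mat d Y" and a: "a \<le> d" "odd a"
  shows "(\<Sum>i<a. \<Sum>j<a. (cmod (Y $$ (i,j) - Y $$ (j,i)))\<^sup>2) \<le> 4 * (real a - 1)"
proof -
  note YD = unitary_matD[OF Y]
  define K where "K = mat a a (\<lambda>(i,j). Y $$ (i,j) - Y $$ (j,i))"
  have K: "K \<in> carrier_mat a a" by (simp add: K_def)
  have "transpose_mat K = (-1) \<cdot>\<^sub>m K" by (rule eq_matI) (auto simp: K_def)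
  then have "det K = det ((-1) \<cdot>\<^sub>m K)" using det_transpose[OF K] by simp
  \<comment> \<open>The scalar leaves the determinant as \<open>(-1) ^ a\<close>, and
    \<open>a\<close> is odd.\<close>
  also have "\<dots> = - det K" using a K by simp
  finally have "det K = 0" by simp
  then obtain v where v: "v \<in> carrier_vec a" "v \<noteq> 0\<^sub>v a" "K *\<^sub>v v = 0\<^sub>v a"
    using det_0_iff_vec_prod_zero[OF K] by blast
  obtain c where c: "(\<Sum>k<a. cnj (c * v $ k) * (c * v $ k)) = 1"
    using exists_normalization[OF v(1,2)] .
  define x where "x k = c * v $ k" for k
  have x1: "(\<Sum>k<a. cnj (x k) * x k) = 1" using c by (simp only: x_def)
  have x1': "(\<Sum>k<a. (cmod (x k))\<^sup>2) = 1"
  proof -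
    have "complex_of_real (\<Sum>k<a. (cmod (x k))\<^sup>2) = (\<Sum>k<a. cnj (x k) * x k)"
      unfolding of_real_sum complex_norm_square by (simp only: mult.commute)
    then show ?thesis using x1 by (simp only: of_real_eq_1_iff)
  qed
  have Kx: "(\<Sum>j<a. K $$ (i,j) * x j) = 0" if "i < a" for i
  proof -
    have "(K *\<^sub>v v) $ i = (\<Sum>j<a. K $$ (i,j) * v $ j)"
      using that K v(1) by (simp add: scalar_prod_def atLeast0LessThan)
    then have "c * (\<Sum>j<a. K $$ (i,j) * v $ j) = 0" using v that by simp
    then show ?thesis by (simp only: x_def sum_distrib_left mult_ac)
  qed
  \<comment> \<open>The block of \<open>Y\<close> and that of its transpose are both contractions,
    so their difference has operator norm at most 2; the constant 4 is its square.\<close>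
  have contr: "(\<Sum>i<a. (cmod (\<Sum>j<a. K $$ (i,j) * z j))\<^sup>2) \<le> 4 * (\<Sum>j<a. (cmod (z j))\<^sup>2)" for z
  proof -
    have "(\<Sum>i<a. (cmod (\<Sum>j<a. K $$ (i,j) * z j))\<^sup>2)
        = (\<Sum>i<a. (cmod ((\<Sum>j<a. Y $$ (i,j) * z j) - (\<Sum>j<a. Y $$ (j,i) * z j)))\<^sup>2)"
      by (intro sum.cong refl) (simp add: K_def left_diff_distrib sum_subtractf)
    also have "\<dots> \<le> (\<Sum>i<a. 2 * ((cmod (\<Sum>j<a. Y $$ (i,j) * z j))\<^sup>2 + (cmod (\<Sum>j<a. Y $$ (j,i) * z j))\<^sup>2))"
      by (intro sum_mono norm_diff_square_le)
    also have "\<dots> = 2 * (\<Sum>i<a. (cmod (\<Sum>j<a. Y $$ (i,j) * z j))\<^sup>2)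
        + 2 * (\<Sum>i<a. (cmod (\<Sum>j<a. transpose_mat Y $$ (i,j) * z j))\<^sup>2)"
      using YD(1) a by (simp add: sum.distrib sum_distrib_left)
    also have "\<dots> \<le> 4 * (\<Sum>j<a. (cmod (z j))\<^sup>2)"
      using unitary_mat_block_contraction[OF Y a(1), of z]
        unitary_mat_block_contraction[OF unitary_mat_transpose[OF Y] a(1), of z] by linarith
    finally show ?thesis .
  qed
  have col: "(\<Sum>i<a. (cmod (K $$ (i,l)))\<^sup>2) \<le> 4 * (1 - (cmod (x l))\<^sup>2)" if l: "l < a" for l
  proof -
    define z where "z j = (if j = l then 1 else 0) - cnj (x l) * x j" for j
    have "(\<Sum>j<a. K $$ (i,j) * z j) = K $$ (i,l)" if "i < a" for i
    proof -
      have "(\<Sum>j<a. K $$ (i,j) * z j)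
          = (\<Sum>j<a. if j = l then K $$ (i,j) else 0) - cnj (x l) * (\<Sum>j<a. K $$ (i,j) * x j)"
        unfolding sum_distrib_left sum_subtractf[symmetric]
        by (intro sum.cong refl) (simp add: z_def algebra_simps)
      then show ?thesis using Kx[OF that] l by simp
    qed
    then have "(\<Sum>i<a. (cmod (K $$ (i,l)))\<^sup>2) \<le> 4 * (\<Sum>j<a. (cmod (z j))\<^sup>2)"
      using contr[of z] by simp
    also have "(\<Sum>j<a. (cmod (z j))\<^sup>2) = 1 - (cmod (x l))\<^sup>2"
    proof -
      have "complex_of_real (\<Sum>j<a. (cmod (z j))\<^sup>2) = (\<Sum>j<a. cnj (z j) * z j)"
        unfolding of_real_sum complex_norm_square by (simp only: mult.commute)
      also have "\<dots> = (\<Sum>j<a. (if j = l then 1 - cnj (x l) * x j - x l * cnj (x j) else 0)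
          + cnj (x l) * x l * (cnj (x j) * x j))"
        by (intro sum.cong refl) (simp add: z_def algebra_simps)
      also have "\<dots> = 1 - cnj (x l) * x l"
        unfolding sum.distrib sum_distrib_left[symmetric] x1 using l by simp
      also have "\<dots> = complex_of_real (1 - (cmod (x l))\<^sup>2)"
        unfolding of_real_diff complex_norm_square by (simp add: mult.commute)
      finally show ?thesis by (simp only: of_real_eq_iff)
    qed
    finally show ?thesis .
  qed
  have "(\<Sum>i<a. \<Sum>j<a. (cmod (Y $$ (i,j) - Y $$ (j,i)))\<^sup>2) = (\<Sum>i<a. \<Sum>j<a. (cmod (K $$ (i,j)))\<^sup>2)"
    by (simp add: K_def)
  also have "\<dots> = (\<Sum>j<a. \<Sum>i<a. (cmod (K $$ (i,j)))\<^sup>2)" by (rule sum.swap)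
  also have "\<dots> \<le> (\<Sum>l<a. 4 * (1 - (cmod (x l))\<^sup>2))" by (intro sum_mono col) auto
  also have "\<dots> = 4 * (real a - 1)"
    unfolding sum_distrib_left[symmetric] sum_subtractf x1' by simp
  finally show ?thesis .
qed

section \<open>Lower bounds for the partial sums\<close>

text \<open>Polarisation: with p and q at transposed positions, this separates the entry norms,
  fixed by unitarity on full rows and columns, from the antisymmetric part.\<close>

lemma Re_cnj_mult_eq: "Re (cnj p * q) = ((cmod p)\<^sup>2 + (cmod q)\<^sup>2 - (cmod (p - q))\<^sup>2) / 2"
  unfolding cmod_power2 by (simp add: power2_eq_square field_simps)

lemma Re_cnj_mult_ge: "- ((cmod p)\<^sup>2 + (cmod q)\<^sup>2) / 2 \<le> Re (cnj p * q)"
  unfolding Re_cnj_mult_eq using norm_diff_square_le[of p q] by simp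

text \<open>Each row contributes at least -1, because the truncated row \<open>i\<close> and the
  truncated column \<open>i\<close> of a unitary both have norm at most 1.\<close>

lemma block_sum_ge:
  assumes Y: "unitary_mat d Y" and "a \<le> d" "b \<le> d"
  shows "- real a \<le> (\<Sum>i<a. \<Sum>j<b. Re (cnj (Y $$ (i,j)) * Y $$ (j,i)))"
proof -
  have "(\<Sum>j<b. Re (cnj (Y $$ (i,j)) * Y $$ (j,i))) \<ge> - 1" if "i < a" for i
  proof -
    have i: "i < d" using that assms by simp
    have le: "(\<Sum>j<b. f j) \<le> (\<Sum>j<d. f j)" if "\<And>j. f j \<ge> 0" for f :: "nat \<Rightarrow> real"
      using assms that by (intro sum_mono2) auto
    have "(\<Sum>j<b. (cmod (Y $$ (i,j)))\<^sup>2) \<le> 1" "(\<Sum>j<b. (cmod (Y $$ (j,i)))\<^sup>2) \<le> 1"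
      using le[of "\<lambda>j. (cmod (Y $$ (i,j)))\<^sup>2"] le[of "\<lambda>j. (cmod (Y $$ (j,i)))\<^sup>2"]
        unitary_mat_row_norm[OF Y i] unitary_mat_col_norm[OF Y i] by simp_all
    then have "- 1 \<le> (\<Sum>j<b. - ((cmod (Y $$ (i,j)))\<^sup>2 + (cmod (Y $$ (j,i)))\<^sup>2) / 2)"
      by (simp add: sum_negf sum.distrib sum_subtractf flip: sum_divide_distrib)
    also have "\<dots> \<le> (\<Sum>j<b. Re (cnj (Y $$ (i,j)) * Y $$ (j,i)))"
      by (intro sum_mono Re_cnj_mult_ge)
    finally show ?thesis .
  qed
  then have "(\<Sum>i<a. - 1) \<le> (\<Sum>i<a. \<Sum>j<b. Re (cnj (Y $$ (i,j)) * Y $$ (j,i)))"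
    by (intro sum_mono) auto
  then show ?thesis by simp
qed

text \<open>The entry norms of a proper block are not known, so they are bounded below by the
  antisymmetric part: each summand is at least minus a quarter of the squared difference.\<close>

lemma odd_block_sum_ge:
  assumes Y: "unitary_mat d Y" and a: "a \<le> d" "odd a"
  shows "- (real a - 1) \<le> (\<Sum>i<a. \<Sum>j<a. Re (cnj (Y $$ (i,j)) * Y $$ (j,i)))"
proof -
  have *: "- (cmod (p - q))\<^sup>2 / 4 \<le> Re (cnj p * q)" for p q
    unfolding Re_cnj_mult_eq using norm_diff_square_le[of p q] by simp
  have "- (real a - 1) \<le> (\<Sum>i<a. \<Sum>j<a. - (cmod (Y $$ (i,j) - Y $$ (j,i)))\<^sup>2 / 4)"
    using antisymmetric_part_odd_block[OF Y a] by (simp add: sum_negf flip: sum_divide_distrib)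
  also have "\<dots> \<le> (\<Sum>i<a. \<Sum>j<a. Re (cnj (Y $$ (i,j)) * Y $$ (j,i)))"
    by (intro sum_mono *)
  finally show ?thesis .
qed

text \<open>For the full matrix the entry norms are known exactly: both sums equal d, and
  polarisation gives (d + d - 4(d - 1)) / 2 = -(d - 2), one better than the bound for a proper
  block.\<close>

lemma odd_full_sum_ge:
  assumes Y: "unitary_mat d Y" and d: "odd d"
  shows "- (real d - 2) \<le> (\<Sum>i<d. \<Sum>j<d. Re (cnj (Y $$ (i,j)) * Y $$ (j,i)))"
proof -
  have "(\<Sum>i<d. \<Sum>j<d. (cmod (Y $$ (i,j)))\<^sup>2) = real d"
    using unitary_mat_row_norm[OF Y] by simp
  moreover have "(\<Sum>i<d. \<Sum>j<d. (cmod (Y $$ (j,i)))\<^sup>2) = real d"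
    using unitary_mat_col_norm[OF Y] by simp
  ultimately show ?thesis
    using antisymmetric_part_odd_block[OF Y order_refl d]
    unfolding Re_cnj_mult_eq by (simp add: sum_subtractf sum.distrib flip: sum_divide_distrib)
qed

text \<open>The minimiser is the direct sum of blocks \<open>[[0,1],[-1,0]]\<close>, followed by a single entry \<open>1\<close> if
  \<open>d\<close> is odd; indices start at 0, so the pairs are \<open>(2i, 2i+1)\<close>.\<close>

definition partner :: "nat \<Rightarrow> nat \<Rightarrow> nat" where
  "partner d i = (if odd i then i - 1 else if Suc i < d then Suc i else i)"

text \<open>The real parts that the minimiser produces, tabulated separately so that their sums
  involve no complex arithmetic.\<close>

definition pair_form :: "nat \<Rightarrow> nat \<Rightarrow> nat \<Rightarrow> real" where
  "pair_form d i j = (if j = partner d i then if j = i then 1 else - 1 else 0)"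

definition pair_unitary :: "nat \<Rightarrow> complex mat" where
  "pair_unitary d = mat d d (\<lambda>(i,j). if j = partner d i then if odd i then - 1 else 1 else 0)"

lemma partner_less: "i < d \<Longrightarrow> partner d i < d"
  by (auto simp: partner_def)

lemma partner_eq_self_iff: "partner d i = i \<longleftrightarrow> even i \<and> \<not> Suc i < d"
  by (cases i) (auto simp: partner_def)

lemma partner_partner: "i < d \<Longrightarrow> partner d (partner d i) = i"
  by (auto simp: partner_def elim!: oddE)

lemma partner_eq_iff: "i < d \<Longrightarrow> j < d \<Longrightarrow> j = partner d i \<longleftrightarrow> i = partner d j"
  using partner_partner by metis

lemma pair_form_sym: "i < d \<Longrightarrow> j < d \<Longrightarrow> pair_form d i j = pair_form d j i"
  using partner_eq_iff by (auto simp: pair_form_def)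

lemma unitary_pair_unitary: "unitary_mat d (pair_unitary d)"
proof -
  have "(\<Sum>k<d. cnj (pair_unitary d $$ (k,i)) * pair_unitary d $$ (k,j)) = (if i = j then 1 else 0)"
    if ij: "i < d" "j < d" for i j
  proof -
    have "(\<Sum>k<d. cnj (pair_unitary d $$ (k,i)) * pair_unitary d $$ (k,j))
        = (\<Sum>k<d. if k = partner d i then if i = j then 1 else 0 else 0)"
    proof (intro sum.cong refl)
      fix k assume "k \<in> {..<d}"
      then show "cnj (pair_unitary d $$ (k,i)) * pair_unitary d $$ (k,j)
        = (if k = partner d i then if i = j then 1 else 0 else 0)"
        using ij partner_eq_iff[of k d i] partner_eq_iff[of k d j] by (auto simp: pair_unitary_def)
    qed
    then show ?thesis using partner_less[OF ij(1)] by simp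
  qed
  then show ?thesis by (subst unitary_mat_iff) (auto simp: pair_unitary_def)
qed

text \<open>Distinct partners have opposite parity, hence entries of opposite sign and product -1.
  An index that is its own partner is even, so its entry is 1.\<close>

lemma pair_unitary_form:
  assumes "i < d" "j < d"
  shows "Re (cnj (pair_unitary d $$ (i,j)) * pair_unitary d $$ (j,i)) = pair_form d i j"
proof (cases "j = partner d i")
  case True
  have "pair_unitary d $$ (i,j) = (if odd i then - 1 else 1)"
    using assms True by (simp add: pair_unitary_def)
  moreover have "pair_unitary d $$ (j,i) = (if odd j then - 1 else 1)"
    using assms partner_eq_iff[OF assms] True by (simp add: pair_unitary_def)
  moreover have "pair_form d i j = (if j = i then 1 else - 1)"
    using True by (simp add: pair_form_def)
  moreover have "i = j \<Longrightarrow> even i" using True partner_eq_self_iff by metis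
  moreover have "i \<noteq> j \<Longrightarrow> odd i \<longleftrightarrow> even j"
    using True by (auto simp: partner_def split: if_splits elim!: oddE)
  ultimately show ?thesis
    by (cases "i = j"; cases "odd i") simp_all
qed (use assms in \<open>simp_all add: pair_unitary_def pair_form_def\<close>)

lemma sum_pair_form:
  fixes f :: "nat \<Rightarrow> real"
  assumes "i < d"
  shows "(\<Sum>j<b. f j * pair_form d i j)
    = (if partner d i < b then if partner d i = i then f i else - f (partner d i) else 0)"
proof -
  have "(\<Sum>j<b. f j * pair_form d i j) = (\<Sum>j<b. if j = partner d i then if j = i then f j else - f j else 0)"
    by (intro sum.cong) (auto simp: pair_form_def)
  then show ?thesis by simp
qed

section \<open>Optimality and value of the pairing\<close>

text \<open>Every row whose partner column is distinct and lies among the first \<open>b\<close>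
  contributes -1. The only possible exception is the last row when \<open>a = b\<close> is odd: it
  gives 0 if its partner lies outside the block, and 1 if the block is the whole matrix. The totals
  match the three lower bounds above.\<close>

lemma pair_form_partial_sums_minimal:
  assumes Y: "unitary_mat d Y" and ab: "a \<le> b" "b \<le> d"
  shows "(\<Sum>i<a. \<Sum>j<b. pair_form d i j) \<le> (\<Sum>i<a. \<Sum>j<b. Re (cnj (Y $$ (i,j)) * Y $$ (j,i)))"
proof -
  define r where "r i = (if partner d i < b then if partner d i = i then 1 else - 1 else (0::real))" for i
  have lhs: "(\<Sum>i<a. \<Sum>j<b. pair_form d i j) = (\<Sum>i<a. r i)"
    using ab sum_pair_form[where f = "\<lambda>_. 1"] by (intro sum.cong) (auto simp: r_def)
  show ?thesis
  proof (cases "a < b \<or> even a")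
    case True
    \<comment> \<open>Only the last row could have its partner outside: \<open>a < b\<close> makes
      room for it, and for even \<open>a\<close> that partner is \<open>a - 2\<close>.\<close>
    have "r i = - 1" if "i < a" for i
    proof -
      have "even i \<Longrightarrow> Suc i < b" using that True ab by (auto elim!: evenE)
      then have "partner d i < b" "partner d i \<noteq> i"
        using that ab unfolding partner_eq_self_iff by (auto simp: partner_def)
      then show ?thesis by (simp add: r_def)
    qed
    then have "(\<Sum>i<a. r i) = - real a" by simp
    then show ?thesis using block_sum_ge[OF Y, of a b] ab lhs by simp
  next
    case False
    then have eq: "b = a" "odd a" using ab by auto
    then obtain m where m: "a = Suc (2 * m)" by (auto elim: oddE)
    have "r i = - 1" if "i < 2 * m" for i
    proof -
      have "even i \<Longrightarrow> Suc i < b" using that m eq by (auto elim!: evenE)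
      then have "partner d i < b" "partner d i \<noteq> i"
        using that m eq ab unfolding partner_eq_self_iff by (auto simp: partner_def)
      then show ?thesis by (simp add: r_def)
    qed
    then have sum: "(\<Sum>i<a. r i) = - (real a - 1) + r (2 * m)" by (simp add: m)
    show ?thesis
    proof (cases "a = d")
      case True
      then have "r (2 * m) = 1" using m eq by (simp add: r_def partner_def)
      then show ?thesis using odd_full_sum_ge[OF Y] lhs sum True eq by simp
    next
      case False
      then have "r (2 * m) = 0" using m eq ab by (simp add: r_def partner_def)
      then show ?thesis using odd_block_sum_ge[OF Y] lhs sum eq ab by simp
    qed
  qed
qed

lemma pair_form_minimal:
  assumes Y: "unitary_mat d Y"
    and "\<And>i. Suc i < d \<Longrightarrow> \<sigma> (Suc i) \<le> \<sigma> i" "\<And>i. i < d \<Longrightarrow> 0 \<le> \<sigma> i"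
  shows "(\<Sum>i<d. \<Sum>j<d. \<sigma> i * \<sigma> j * pair_form d i j)
    \<le> (\<Sum>i<d. \<Sum>j<d. \<sigma> i * \<sigma> j * Re (cnj (Y $$ (i,j)) * Y $$ (j,i)))"
proof (rule decreasing_weights_sum_mono[where d = d and \<sigma> = \<sigma>, OF assms(2,3)])
  fix a b assume ab: "a \<le> d" "b \<le> d"
  show "(\<Sum>i<a. \<Sum>j<b. pair_form d i j) \<le> (\<Sum>i<a. \<Sum>j<b. Re (cnj (Y $$ (i,j)) * Y $$ (j,i)))"
  proof (cases "a \<le> b")
    case True
    then show ?thesis using pair_form_partial_sums_minimal[OF Y] ab by blast
  next
    case False
    \<comment> \<open>Both summands are symmetric in \<open>i\<close> and \<open>j\<close>, so the
      case of more rows than columns follows by exchanging them.\<close>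
    have "(\<Sum>i<a. \<Sum>j<b. pair_form d i j) = (\<Sum>j<b. \<Sum>i<a. pair_form d j i)"
      using ab pair_form_sym by (subst sum.swap) (auto intro!: sum.cong)
    also have "\<dots> \<le> (\<Sum>j<b. \<Sum>i<a. Re (cnj (Y $$ (j,i)) * Y $$ (i,j)))"
      using pair_form_partial_sums_minimal[OF Y] ab False by simp
    also have "\<dots> = (\<Sum>i<a. \<Sum>j<b. Re (cnj (Y $$ (i,j)) * Y $$ (j,i)))"
      by (subst sum.swap) (simp add: mult.commute)
    finally show ?thesis .
  qed
qed

lemma sum_lessThan_double:
  fixes f :: "nat \<Rightarrow> 'a::comm_monoid_add"
  shows "(\<Sum>i<2*m. f i) = (\<Sum>i<m. f (2*i) + f (2*i+1))"
  by (induction m) (simp_all add: add.assoc)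

text \<open>Both rows of a pair contribute the same product, hence the factor 2; for odd
  \<open>d\<close> the unpaired last index contributes its square.\<close>

lemma pair_form_value:
  "(\<Sum>i<d. \<Sum>j<d. \<sigma> i * \<sigma> j * pair_form d i j) =
    (if even d then - 2 * (\<Sum>i<d div 2. \<sigma> (2*i) * \<sigma> (2*i+1))
     else - 2 * (\<Sum>i<d div 2. \<sigma> (2*i) * \<sigma> (2*i+1)) + (\<sigma> (d-1))\<^sup>2)"
proof -
  define r where "r i = \<sigma> i * (if partner d i = i then \<sigma> i else - \<sigma> (partner d i))" for i
  have "(\<Sum>j<d. \<sigma> i * \<sigma> j * pair_form d i j) = r i" if "i < d" for i
    using sum_pair_form[OF that, of \<sigma> d] partner_less[OF that]
    by (simp add: r_def mult.assoc flip: sum_distrib_left)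
  then have eq: "(\<Sum>i<d. \<Sum>j<d. \<sigma> i * \<sigma> j * pair_form d i j) = (\<Sum>i<d. r i)" by simp
  have r2: "(\<Sum>i<2*m. r i) = - 2 * (\<Sum>i<m. \<sigma> (2*i) * \<sigma> (2*i+1))" if "2 * m \<le> d" for m
    unfolding sum_lessThan_double sum_distrib_left
    using that by (intro sum.cong refl) (auto simp: r_def partner_def)
  show ?thesis
  proof (cases "even d")
    case True
    then show ?thesis using eq r2[of "d div 2"] by simp
  next
    case False
    then obtain m where m: "d = Suc (2 * m)" by (auto elim: oddE)
    then have "r (2 * m) = (\<sigma> (d - 1))\<^sup>2" by (simp add: r_def partner_def power2_eq_square)
    then show ?thesis using eq r2[of m] m by simp
  qed
qed

subsection \<open>Traces against Choi states\<close>

text \<open>Splits a sum over the tensor space into one over pairs, following the encoding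
  \<open>k*d+l\<close> of the basis.\<close>

lemma sum_lessThan_mult:
  fixes f :: "nat \<Rightarrow> 'a::comm_monoid_add"
  shows "(\<Sum>i<n*k. f i) = (\<Sum>m<n. \<Sum>l<k. f (m*k+l))"
proof -
  have add: "(\<Sum>i<a+k. f i) = (\<Sum>i<a. f i) + (\<Sum>l<k. f (a+l))" for a k
    by (induction k) (simp_all add: add.assoc)
  show ?thesis by (induction n) (simp_all add: add add.commute[of k])
qed

lemma pair_index_less: "k < d \<Longrightarrow> l < d \<Longrightarrow> k * d + l < d * (d::nat)"
proof -
  assume "k < d" "l < d"
  then have "k * d + l < Suc k * d" by simp
  also have "\<dots> \<le> d * d" using \<open>k < d\<close> by (intro mult_right_mono) auto
  finally show ?thesis .
qed

lemma index_mult_mat_pair_sum: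
  assumes "A \<in> carrier_mat (d*d) (d*d)" "B \<in> carrier_mat (d*d) (d*d)" "i < d*d" "j < d*d"
  shows "(A * B) $$ (i,j) = (\<Sum>m<d. \<Sum>n<d. A $$ (i,m*d+n) * B $$ (m*d+n,j))"
  by (simp only: index_mult_mat_sum[OF assms] sum_lessThan_mult)

lemma kron_one_carrier [simp]: "B \<in> carrier_mat d d \<Longrightarrow> kron (1\<^sub>m d) B \<in> carrier_mat (d*d) (d*d)"
  by (simp add: kron_def)

lemma kron_one_index:
  assumes "B \<in> carrier_mat d d" "k < d" "l < d" "m < d" "n < d"
  shows "kron (1\<^sub>m d) B $$ (k*d+l, m*d+n) = (if m = k then B $$ (l,n) else 0)"
  using assms by (auto simp: kron_def pair_index_less)

lemma flip_carrier [simp]: "flip d \<in> carrier_mat (d*d) (d*d)"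
  by (simp add: flip_def)

lemma flip_index:
  assumes "m < d" "n < d" "p < d" "q < d"
  shows "flip d $$ (m*d+n, p*d+q) = (if m = q then if n = p then 1 else 0 else 0)"
proof -
  have "m*d+n = q*d+p \<longleftrightarrow> m = q \<and> n = p"
  proof
    assume eq: "m*d+n = q*d+p"
    have "m = (m*d+n) div d" "n = (m*d+n) mod d" using assms by auto
    then show "m = q \<and> n = p" unfolding eq using assms by auto
  qed auto
  then show ?thesis using assms by (simp add: flip_def pair_index_less)
qed

lemma ketbra_omega_carrier [simp]: "ketbra (omega d) \<in> carrier_mat (d*d) (d*d)"
  by (simp add: ketbra_def omega_def)

lemma ketbra_omega_index:
  assumes "m < d" "n < d" "p < d" "q < d"
  shows "ketbra (omega d) $$ (m*d+n, p*d+q) = (if m = n then if p = q then 1 / of_nat d else 0 else 0)"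
proof -
  have "complex_of_real (sqrt (real d)) * complex_of_real (sqrt (real d)) = of_nat d"
    by (simp flip: of_real_mult)
  then show ?thesis using assms by (simp add: ketbra_def omega_def pair_index_less)
qed

lemma flip_conjugation_carrier:
  "B \<in> carrier_mat d d \<Longrightarrow> kron (1\<^sub>m d) B * flip d * kron (1\<^sub>m d) (adj B) \<in> carrier_mat (d*d) (d*d)"
  by (intro mult_carrier_mat[of _ _ "d*d"]) auto

text \<open>On a basis vector the operator first applies the adjoint of \<open>B\<close> to the
  second factor, then swaps, then applies \<open>B\<close>: column (k',l') is the tensor product of
  column l' of \<open>adj B\<close> with column k' of \<open>B\<close>.\<close>

lemma flip_conjugation_index:
  assumes B: "B \<in> carrier_mat d d" and k: "k < d" "l < d" "k' < d" "l' < d"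
  shows "(kron (1\<^sub>m d) B * flip d * kron (1\<^sub>m d) (adj B)) $$ (k*d+l, k'*d+l')
    = B $$ (l,k') * cnj (B $$ (l',k))"
proof -
  note c = kron_one_carrier[OF B] flip_carrier[of d] kron_one_carrier[OF adj_carrier[OF B]]
  have 1: "(kron (1\<^sub>m d) B * flip d) $$ (k*d+l, p*d+q) = (if q = k then B $$ (l,p) else 0)"
    if "p < d" "q < d" for p q
  proof -
    have "(kron (1\<^sub>m d) B * flip d) $$ (k*d+l, p*d+q)
      = (\<Sum>m<d. \<Sum>n<d. (if m = k then B $$ (l,n) else 0) * (if m = q then if n = p then 1 else 0 else 0))"
      using that k c by (simp only: index_mult_mat_pair_sum pair_index_less)
        (intro sum.cong refl, simp add: kron_one_index[OF B] flip_index)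
    also have "\<dots> = (\<Sum>m<d. if m = k then if m = q then B $$ (l,p) else 0 else 0)"
      using that by (intro sum.cong refl) (simp add: mult_delta_right sum.neutral)
    finally show ?thesis using k by auto
  qed
  have "(kron (1\<^sub>m d) B * flip d * kron (1\<^sub>m d) (adj B)) $$ (k*d+l, k'*d+l')
    = (\<Sum>p<d. \<Sum>q<d. (if q = k then B $$ (l,p) else 0) * (if k' = p then cnj (B $$ (l',q)) else 0))"
    using k c mult_carrier_mat[OF c(1,2)] by (simp only: index_mult_mat_pair_sum pair_index_less)
      (intro sum.cong refl, simp add: 1 kron_one_index[OF adj_carrier[OF B]] adj_index[OF B] del: index_mult_mat(1))
  also have "\<dots> = (\<Sum>p<d. if p = k' then B $$ (l,p) * cnj (B $$ (l',k)) else 0)"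
    using k by (intro sum.cong refl) (auto simp: mult_delta_left)
  finally show ?thesis using k by simp
qed

lemma choi_unitary_carrier:
  "U \<in> carrier_mat d d \<Longrightarrow> choi_unitary d U \<in> carrier_mat (d*d) (d*d)"
  unfolding choi_unitary_def by (intro mult_carrier_mat[of _ _ "d*d"]) auto

text \<open>The state is the projection onto the vectorisation of \<open>U\<close>, scaled by
  \<open>1 / sqrt d\<close>.\<close>

lemma choi_unitary_index:
  assumes U: "U \<in> carrier_mat d d" and k: "k < d" "l < d" "k' < d" "l' < d"
  shows "choi_unitary d U $$ (k*d+l, k'*d+l') = U $$ (l,k) * cnj (U $$ (l',k')) / of_nat d"
proof -
  note c = kron_one_carrier[OF U] ketbra_omega_carrier[of d] kron_one_carrier[OF adj_carrier[OF U]]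
  have 1: "(kron (1\<^sub>m d) U * ketbra (omega d)) $$ (k*d+l, p*d+q) = (if q = p then U $$ (l,k) / of_nat d else 0)"
    if "p < d" "q < d" for p q
  proof -
    have "(kron (1\<^sub>m d) U * ketbra (omega d)) $$ (k*d+l, p*d+q)
      = (\<Sum>m<d. \<Sum>n<d. (if m = k then U $$ (l,n) else 0) * (if m = n then if p = q then 1 / of_nat d else 0 else 0))"
      using that k c by (simp only: index_mult_mat_pair_sum pair_index_less)
        (intro sum.cong refl, simp add: kron_one_index[OF U] ketbra_omega_index)
    also have "\<dots> = (\<Sum>m<d. if m = k then if q = p then U $$ (l,k) / of_nat d else 0 else 0)"
      by (intro sum.cong refl) (auto simp: mult_delta_right)
    finally show ?thesis using k by auto
  qed
  have "choi_unitary d U $$ (k*d+l, k'*d+l')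
    = (\<Sum>p<d. \<Sum>q<d. (if q = p then U $$ (l,k) / of_nat d else 0) * (if k' = p then cnj (U $$ (l',q)) else 0))"
    unfolding choi_unitary_def
    using k c mult_carrier_mat[OF c(1,2)] by (simp only: index_mult_mat_pair_sum pair_index_less)
      (intro sum.cong refl, simp add: 1 kron_one_index[OF adj_carrier[OF U]] adj_index[OF U] del: index_mult_mat(1))
  also have "\<dots> = (\<Sum>p<d. if p = k' then U $$ (l,k) * cnj (U $$ (l',p)) / of_nat d else 0)"
    using k by (intro sum.cong refl) (auto simp: mult_delta_left)
  finally show ?thesis using k by simp
qed

section \<open>The witness value as a function of the unitary\<close>

lemma mtrace_mult_sum:
  assumes "A \<in> carrier_mat n m" "B \<in> carrier_mat m n"
  shows "mtrace (A * B) = (\<Sum>i<n. \<Sum>j<m. A $$ (i,j) * B $$ (j,i))"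
  using assms by (simp add: mtrace_def index_mult_mat_sum[of A n m B n] del: index_mult_mat(1))

lemma mtrace_comm:
  assumes "A \<in> carrier_mat n m" "B \<in> carrier_mat m n"
  shows "mtrace (A * B) = mtrace (B * A)"
  unfolding mtrace_mult_sum[OF assms] mtrace_mult_sum[OF assms(2,1)]
  by (subst sum.swap) (simp add: mult.commute)

text \<open>This is \<open>tr (conj A * A)\<close>, with the entrywise conjugate of \<open>A\<close>.\<close>

definition twisted_square :: "nat \<Rightarrow> complex mat \<Rightarrow> complex" where
  "twisted_square d A = (\<Sum>i<d. \<Sum>j<d. cnj (A $$ (i,j)) * A $$ (j,i))"

lemma mtrace_flip_witness_choi:
  assumes B: "B \<in> carrier_mat d d" and U: "unitary_mat d U" and d: "d \<ge> 1"
  shows "mtrace ((kron (1\<^sub>m d) B * flip d * kron (1\<^sub>m d) (adj B) + complex_of_real w \<cdot>\<^sub>m 1\<^sub>m (d*d))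
      * choi_unitary d U) = of_real w + twisted_square d (adj B * U) / of_nat d"
proof -
  define V where "V = kron (1\<^sub>m d) B * flip d * kron (1\<^sub>m d) (adj B)"
  note UD = unitary_matD[OF U]
  have V: "V \<in> carrier_mat (d*d) (d*d)" unfolding V_def by (rule flip_conjugation_carrier[OF B])
  note C = choi_unitary_carrier[OF UD(1)]
  let ?C = "choi_unitary d U"
  have A: "(adj B * U) $$ (k,k') = (\<Sum>l<d. cnj (B $$ (l,k)) * U $$ (l,k'))" if "k < d" "k' < d" for k k'
    using that B UD(1) by (simp add: index_mult_mat_sum[of _ d d _ d] del: index_mult_mat(1))
  have "mtrace ((V + of_real w \<cdot>\<^sub>m 1\<^sub>m (d*d)) * ?C)
      = (\<Sum>i<d*d. \<Sum>j<d*d. V $$ (i,j) * ?C $$ (j,i) + (if j = i then of_real w * ?C $$ (i,i) else 0))"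
    using V C by (subst mtrace_mult_sum[of _ "d*d" "d*d"]) (auto simp: distrib_right intro!: sum.cong)
  also have "\<dots> = (\<Sum>i<d*d. \<Sum>j<d*d. V $$ (i,j) * ?C $$ (j,i)) + of_real w * (\<Sum>i<d*d. ?C $$ (i,i))"
    by (simp add: sum.distrib sum_distrib_left)
  \<comment> \<open>The Choi state has trace 1, as every column of \<open>U\<close> is a unit
    vector; the identity part therefore contributes exactly \<open>w\<close>.\<close>
  also have "(\<Sum>i<d*d. ?C $$ (i,i)) = (\<Sum>k<d. \<Sum>l<d. of_real ((cmod (U $$ (l,k)))\<^sup>2) / of_nat d)"
    unfolding sum_lessThan_mult complex_norm_square
    by (intro sum.cong refl) (simp add: choi_unitary_index[OF UD(1)])
  also have "\<dots> = (\<Sum>k<d. 1 / of_nat d)"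
    using unitary_mat_col_norm[OF U] by (intro sum.cong refl) (simp flip: sum_divide_distrib of_real_sum of_real_power)
  also have "\<dots> = 1" using d by simp
  also have "(\<Sum>i<d*d. \<Sum>j<d*d. V $$ (i,j) * ?C $$ (j,i))
      = (\<Sum>k<d. \<Sum>l<d. \<Sum>k'<d. \<Sum>l'<d. (B $$ (l,k') * cnj (U $$ (l,k))) * (cnj (B $$ (l',k)) * U $$ (l',k')) / of_nat d)"
    unfolding sum_lessThan_mult V_def
    by (intro sum.cong refl) (simp add: choi_unitary_index[OF UD(1)] flip_conjugation_index[OF B] mult_ac del: index_mult_mat(1))
  \<comment> \<open>For fixed \<open>k\<close> and \<open>k'\<close> the summand factors over
    \<open>l\<close> and \<open>l'\<close>, and each factor is an entry of \<open>adj B * U\<close>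
    or its conjugate.\<close>
  also have "\<dots> = (\<Sum>k<d. \<Sum>k'<d. (\<Sum>l<d. B $$ (l,k') * cnj (U $$ (l,k))) * (\<Sum>l'<d. cnj (B $$ (l',k)) * U $$ (l',k')) / of_nat d)"
    unfolding sum_product sum_divide_distrib by (intro sum.cong refl sum.swap)
  also have "\<dots> = (\<Sum>k<d. \<Sum>k'<d. cnj ((adj B * U) $$ (k',k)) * (adj B * U) $$ (k,k')) / of_nat d"
    unfolding sum_divide_distrib by (intro sum.cong refl) (simp add: A del: index_mult_mat(1))
  also have "\<dots> = twisted_square d (adj B * U) / of_nat d"
    unfolding twisted_square_def by (subst sum.swap) simp
  finally show ?thesis by (simp add: V_def)
qed

lemma map_mat_cnj_mult:
  assumes "A \<in> carrier_mat n m" "B \<in> carrier_mat m p"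
  shows "map_mat cnj (A * B) = map_mat cnj A * map_mat cnj B"
proof (rule eq_matI)
  fix i j assume "i < dim_row (map_mat cnj A * map_mat cnj B)" "j < dim_col (map_mat cnj A * map_mat cnj B)"
  then have ij: "i < n" "j < p" using assms by auto
  show "map_mat cnj (A * B) $$ (i,j) = (map_mat cnj A * map_mat cnj B) $$ (i,j)"
    using ij assms by (simp add: scalar_prod_def)
qed (use assms in auto)

text \<open>Because one factor is conjugated, the invariance is under congruence with the transpose
  rather than under similarity: \<open>adj P * P\<close> cancels in the middle, and
  \<open>transpose_mat P\<close> meets the conjugate of \<open>P\<close> by cyclicity of the
  trace.\<close>

lemma twisted_square_congruence:
  assumes P: "unitary_mat d P" and T: "T \<in> carrier_mat d d"
  shows "twisted_square d (P * T * transpose_mat P) = twisted_square d T"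
proof -
  have tr: "twisted_square d A = mtrace (map_mat cnj A * A)" if "A \<in> carrier_mat d d" for A
    using that unfolding twisted_square_def by (subst mtrace_mult_sum[of _ d d]) (auto intro!: sum.cong)
  note PD = unitary_matD[OF P]
  note assoc = assoc_mult_mat[of _ d d _ d _ d] mult_carrier_mat[of _ d d _ d]
  let ?c = "map_mat cnj"
  let ?Pt = "transpose_mat P"
  have cPt: "?c ?Pt = adj P" by (rule eq_matI) (use PD in auto)
  have aPt: "adj ?Pt = ?c P" by (rule eq_matI) (use PD in auto)
  have inv: "?Pt * ?c P = 1\<^sub>m d"
    using unitary_matD(3)[OF unitary_mat_transpose[OF P]] by (simp add: aPt)
  have car: "?Pt \<in> carrier_mat d d" "?c P \<in> carrier_mat d d" "?c T \<in> carrier_mat d d" "adj P \<in> carrier_mat d d"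
    using PD T by auto
  have "?c (P * T * ?Pt) * (P * T * ?Pt) = ?c P * (?c T * (adj P * P) * T * ?Pt)"
    using PD(1) T car by (simp add: map_mat_cnj_mult[of _ d d _ d] cPt assoc)
  also have "\<dots> = ?c P * (?c T * T * ?Pt)" using PD T car by simp
  finally have "mtrace (?c (P * T * ?Pt) * (P * T * ?Pt)) = mtrace (?c P * (?c T * T * ?Pt))" by simp
  also have "\<dots> = mtrace ((?c T * T * ?Pt) * ?c P)"
    by (rule mtrace_comm[of _ d d]) (use T car assoc(2) in auto)
  also have "(?c T * T * ?Pt) * ?c P = ?c T * T * (?Pt * ?c P)"
    using T car by (simp add: assoc)
  also have "\<dots> = ?c T * T" using T car assoc(2) by (simp add: inv)
  finally show ?thesis using tr[OF T] tr[of "P * T * ?Pt"] T PD(1) car(1) assoc(2) by simp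
qed

text \<open>The substitution U = V Y P^T is chosen so that \<open>adj B * U\<close> is congruent,
  via \<open>P\<close>, to the diagonal of singular values times \<open>Y\<close>.\<close>

lemma twisted_square_singular_values:
  assumes V: "unitary_mat d V" and P: "unitary_mat d P" and Y: "Y \<in> carrier_mat d d"
    and B: "B = V * diagm d (\<lambda>i. complex_of_real (\<sigma> i)) * adj P"
  shows "Re (twisted_square d (adj B * (V * Y * transpose_mat P)))
    = (\<Sum>i<d. \<Sum>j<d. \<sigma> i * \<sigma> j * Re (cnj (Y $$ (i,j)) * Y $$ (j,i)))"
proof -
  let ?S = "diagm d (\<lambda>i. complex_of_real (\<sigma> i))"
  note VD = unitary_matD[OF V] and PD = unitary_matD[OF P]
  note assoc = assoc_mult_mat[of _ d d _ d _ d] mult_carrier_mat[of _ d d _ d]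
  have "adj ?S = ?S" by (rule eq_matI) (auto simp: diagm_def adj_def)
  then have "adj B = P * ?S * adj V"
    using VD(1) PD(1) by (simp add: B adj_mult[of _ d d _ d] assoc)
  then have "adj B * (V * Y * transpose_mat P) = P * (?S * (adj V * V) * Y) * transpose_mat P"
    using VD(1) PD(1) Y by (simp add: assoc)
  also have "\<dots> = P * (?S * Y) * transpose_mat P" using VD by (simp add: right_mult_one_mat[OF diagm_carrier])
  finally have "twisted_square d (adj B * (V * Y * transpose_mat P)) = twisted_square d (?S * Y)"
    using twisted_square_congruence[OF P, OF assoc(2)[OF diagm_carrier Y]] by simp
  moreover have "(?S * Y) $$ (i,j) = of_real (\<sigma> i) * Y $$ (i,j)" if "i < d" "j < d" for i j
    using that Y by (subst index_mult_mat_sum[of _ d d _ d]) (auto simp: mult_delta_left)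
  ultimately have "twisted_square d (adj B * (V * Y * transpose_mat P))
      = (\<Sum>i<d. \<Sum>j<d. of_real (\<sigma> i * \<sigma> j) * (cnj (Y $$ (i,j)) * Y $$ (j,i)))"
    unfolding twisted_square_def by (auto intro!: sum.cong)
  then show ?thesis by (simp add: algebra_simps)
qed

section \<open>From mixtures to single unitary channels\<close>

lemma mtrace_mult_mixture:
  assumes W: "W \<in> carrier_mat n n" and C: "\<And>k. k < m \<Longrightarrow> C k \<in> carrier_mat n n"
  shows "mtrace (W * mat n n (\<lambda>(i,j). \<Sum>k<m. complex_of_real (p k) * C k $$ (i,j)))
    = (\<Sum>k<m. complex_of_real (p k) * mtrace (W * C k))"
proof -
  have "mtrace (W * mat n n (\<lambda>(i,j). \<Sum>k<m. complex_of_real (p k) * C k $$ (i,j)))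
    = (\<Sum>i<n. \<Sum>j<n. \<Sum>k<m. complex_of_real (p k) * (W $$ (i,j) * C k $$ (j,i)))"
    using W by (subst mtrace_mult_sum[of _ n n]) (auto simp: sum_distrib_left mult_ac intro!: sum.cong)
  also have "\<dots> = (\<Sum>k<m. \<Sum>i<n. \<Sum>j<n. complex_of_real (p k) * (W $$ (i,j) * C k $$ (j,i)))"
    unfolding sum.swap[of _ "{..<m}" "{..<n}"] ..
  also have "\<dots> = (\<Sum>k<m. complex_of_real (p k) * mtrace (W * C k))"
    using W C by (intro sum.cong refl) (simp add: mtrace_mult_sum[of _ n n] sum_distrib_left)
  finally show ?thesis .
qed

lemma choi_unitary_in_hull:
  assumes "unitary_mat d U"
  shows "choi_unitary d U \<in> unitary_choi_hull d"
proof -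
  have "choi_unitary d U = mat (d*d) (d*d) (\<lambda>(i,j). \<Sum>k<(1::nat). complex_of_real 1 * choi_unitary d U $$ (i,j))"
    by (rule eq_matI) (use choi_unitary_carrier[OF unitary_matD(1)[OF assms]] in auto)
  then show ?thesis using assms unfolding unitary_choi_hull_def
    by (intro CollectI exI[of _ "1::nat"] exI[of _ "\<lambda>_. 1"] exI[of _ "\<lambda>_. U"]) simp
qed

text \<open>The trace is linear in the state, so nonnegativity need only be tested on the generators
  of the hull.\<close>

lemma hull_trace_nonneg_iff:
  assumes W: "W \<in> carrier_mat (d*d) (d*d)"
  shows "(\<forall>\<rho>\<in>unitary_choi_hull d. Re (mtrace (W * \<rho>)) \<ge> 0)
    \<longleftrightarrow> (\<forall>U. unitary_mat d U \<longrightarrow> Re (mtrace (W * choi_unitary d U)) \<ge> 0)"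
proof (intro iffI ballI)
  fix \<rho> assume pos: "\<forall>U. unitary_mat d U \<longrightarrow> Re (mtrace (W * choi_unitary d U)) \<ge> 0"
    and "\<rho> \<in> unitary_choi_hull d"
  then obtain n p Us where Us: "\<And>k. k < n \<Longrightarrow> p k \<ge> 0 \<and> unitary_mat d (Us k)"
    and \<rho>: "\<rho> = mat (d*d) (d*d) (\<lambda>(i,j). \<Sum>k<(n::nat). complex_of_real (p k) * choi_unitary d (Us k) $$ (i,j))"
    unfolding unitary_choi_hull_def by blast
  have "mtrace (W * \<rho>) = (\<Sum>k<n. complex_of_real (p k) * mtrace (W * choi_unitary d (Us k)))"
    unfolding \<rho> by (rule mtrace_mult_mixture[OF W]) (use Us choi_unitary_carrier unitary_matD(1) in blast)
  then have "Re (mtrace (W * \<rho>)) = (\<Sum>k<n. p k * Re (mtrace (W * choi_unitary d (Us k))))" by simp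
  also have "\<dots> \<ge> 0" using Us pos by (intro sum_nonneg mult_nonneg_nonneg) auto
  finally show "Re (mtrace (W * \<rho>)) \<ge> 0" .
qed (use choi_unitary_in_hull in auto)

theorem theorem3:
  fixes d :: nat and B :: "complex mat" and s :: "nat \<Rightarrow> real" and w :: real
  assumes "d \<ge> 1"
    and "B \<in> carrier_mat d d"
    and "singular_values d B s"
  defines "W \<equiv> kron (1\<^sub>m d) B * flip d * kron (1\<^sub>m d) (adj B) + complex_of_real w \<cdot>\<^sub>m 1\<^sub>m (d*d)"
  shows "(\<forall>\<sigma>\<in>unitary_choi_hull d. Re (mtrace (W * \<sigma>)) \<ge> 0) \<longleftrightarrow>
         w \<ge> (if even d
              then 2 * (\<Sum>i=1..d div 2. s (2*i-1) * s (2*i)) / real d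
              else (2 * (\<Sum>i=1..(d-1) div 2. s (2*i-1) * s (2*i)) - (s d)\<^sup>2) / real d)"
proof -
  \<comment> \<open>Shift from singular values numbered from 1 to the indices from 0 used for
    matrices.\<close>
  define \<sigma> where "\<sigma> i = s (Suc i)" for i
  note sv = assms(3)[unfolded singular_values_def]
  have dec: "\<sigma> (Suc i) \<le> \<sigma> i" if "Suc i < d" for i
    using that sv by (auto simp: \<sigma>_def)
  have nonneg: "0 \<le> \<sigma> i" if "i < d" for i
    using that sv by (auto simp: \<sigma>_def)
  have "char_poly (adj B * B) = (\<Prod>i=1..d. [:- complex_of_real ((s i)\<^sup>2), 1:])"
    using sv by blast
  also have "\<dots> = (\<Prod>i<d. [:- complex_of_real ((\<sigma> i)\<^sup>2), 1:])"
    by (simp add: \<sigma>_def prod.atLeast1_atMost_eq)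
  finally obtain V P where V: "unitary_mat d V" and P: "unitary_mat d P"
    and SVD: "B = V * diagm d (\<lambda>i. complex_of_real (\<sigma> i)) * adj P"
    using singular_value_decomposition[OF assms(2)] by blast
  note VD = unitary_matD[OF V] and Pt = unitary_mat_transpose[OF P]
  note PtD = unitary_matD[OF Pt]
  define F where "F Y = (\<Sum>i<d. \<Sum>j<d. \<sigma> i * \<sigma> j * Re (cnj (Y $$ (i,j)) * Y $$ (j,i)))" for Y
  define T where "T = (\<Sum>i<d. \<Sum>j<d. \<sigma> i * \<sigma> j * pair_form d i j)"
  have W: "W \<in> carrier_mat (d*d) (d*d)"
    unfolding W_def using flip_conjugation_carrier[OF assms(2)] by simp
  have val: "Re (mtrace (W * choi_unitary d (V * Y * transpose_mat P))) = w + F Y / real d"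
    if Y: "unitary_mat d Y" for Y
    using twisted_square_singular_values[OF V P unitary_matD(1)[OF Y] SVD]
    unfolding W_def F_def
    by (simp add: mtrace_flip_witness_choi[OF assms(2) unitary_mat_mult[OF unitary_mat_mult[OF V Y] Pt] assms(1)])
  have "(\<forall>\<sigma>\<in>unitary_choi_hull d. Re (mtrace (W * \<sigma>)) \<ge> 0)
      \<longleftrightarrow> (\<forall>U. unitary_mat d U \<longrightarrow> Re (mtrace (W * choi_unitary d U)) \<ge> 0)"
    by (rule hull_trace_nonneg_iff[OF W])
  also have "\<dots> \<longleftrightarrow> (\<forall>Y. unitary_mat d Y \<longrightarrow> w + F Y / real d \<ge> 0)"
  proof (intro iffI allI impI)
    fix Y assume "\<forall>U. unitary_mat d U \<longrightarrow> Re (mtrace (W * choi_unitary d U)) \<ge> 0" "unitary_mat d Y"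
    then show "w + F Y / real d \<ge> 0"
      using val unitary_mat_mult[OF unitary_mat_mult[OF V] Pt] by metis
  next
    fix U assume *: "\<forall>Y. unitary_mat d Y \<longrightarrow> w + F Y / real d \<ge> 0" and U: "unitary_mat d U"
    note UD = unitary_matD[OF U]
    \<comment> \<open>The inverse of the substitution U = V Y P^T, which shows that every unitary
      \<open>U\<close> is reached.\<close>
    define Y where "Y = adj V * U * adj (transpose_mat P)"
    have Y: "unitary_mat d Y"
      unfolding Y_def by (intro unitary_mat_mult unitary_mat_adj V U Pt)
    have "V * Y * transpose_mat P = (V * adj V) * U * (adj (transpose_mat P) * transpose_mat P)"
      unfolding Y_def using VD(1) UD(1) PtD(1)
      by (simp add: assoc_mult_mat[of _ d d _ d _ d] mult_carrier_mat[of _ d d _ d])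
    also have "\<dots> = U" using VD(3) UD(1) PtD(2) by simp
    finally show "Re (mtrace (W * choi_unitary d U)) \<ge> 0" using val[OF Y] * Y by simp
  qed
  also have "\<dots> \<longleftrightarrow> w + T / real d \<ge> 0"
  proof
    assume "\<forall>Y. unitary_mat d Y \<longrightarrow> w + F Y / real d \<ge> 0"
    \<comment> \<open>\<open>T\<close> is attained, so the condition at this one unitary already
      gives the bound on \<open>w\<close>.\<close>
    moreover have "F (pair_unitary d) = T"
      unfolding F_def T_def by (intro sum.cong refl) (simp only: lessThan_iff pair_unitary_form)
    ultimately show "w + T / real d \<ge> 0" using unitary_pair_unitary[of d] by metis
  next
    assume *: "w + T / real d \<ge> 0"
    have "T \<le> F Y" if "unitary_mat d Y" for Y
      unfolding T_def F_def by (rule pair_form_minimal[where \<sigma> = \<sigma>, OF that dec nonneg])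
    then have "w + T / real d \<le> w + F Y / real d" if "unitary_mat d Y" for Y
      using that by (intro add_left_mono divide_right_mono) auto
    then show "\<forall>Y. unitary_mat d Y \<longrightarrow> w + F Y / real d \<ge> 0" using * order_trans by blast
  qed
  also have "\<dots> \<longleftrightarrow> w \<ge> - T / real d" by auto
  also have "- T / real d = (if even d
      then 2 * (\<Sum>i=1..d div 2. s (2*i-1) * s (2*i)) / real d
      else (2 * (\<Sum>i=1..(d-1) div 2. s (2*i-1) * s (2*i)) - (s d)\<^sup>2) / real d)"
  proof -
    have "(\<Sum>i=1..m. s (2*i-1) * s (2*i)) = (\<Sum>i<m. \<sigma> (2*i) * \<sigma> (2*i+1))" for m
      by (simp add: \<sigma>_def sum.atLeast1_atMost_eq)
    moreover have "(d - 1) div 2 = d div 2" if "odd d" using that by (auto elim!: oddE)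
    moreover have "\<sigma> (d - 1) = s d" using assms(1) by (simp add: \<sigma>_def)
    ultimately show ?thesis unfolding T_def pair_form_value by (simp add: diff_divide_distrib)
  qed
  finally show ?thesis .
qed

end
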